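(* For every integer $d\ge 1$ and every integer $m\ge 0$, $$A_{2m}^{(d+1)}=\binom{2m}{m}\sum_{k=0}^{m}\binom{m}{k}^2\,\frac{A_{2k}^{(d)}}{\binom{2k}{k}}.$$
   Context: For integers $d\ge 1$, $m\ge 0$, $A_{2m}^{(d)}$ is the number of closed walks of length $2m$ in $\mathbb Z^d$, i.e. the number of sequences of $2m$ steps, each one of $\pm e_1,\dots,\pm e_d$, starting at the origin and ending at the origin; $A_0^{(d)}=1$. *)

theory Defs
  imports Complex_Main "HOL-Library.Function_Algebras"
begin

text \<open>
  Points of the lattice \<open>\<int>\<^sup>d\<close> are functions \<open>nat \<Rightarrow> int\<close> vanishing outside \<open>{..<d}\<close>, with the
  pointwise additive structure, so that the dimension can vary within one statement. The
  coordinates are numbered from \<open>0\<close> to \<open>d - 1\<close>.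
\<close>

definition unit_vec :: "nat \<Rightarrow> nat \<Rightarrow> int" where
  "unit_vec i = (\<lambda>j. if j = i then 1 else 0)"

definition steps :: "nat \<Rightarrow> (nat \<Rightarrow> int) set" where
  "steps d = {unit_vec i | i. i < d} \<union> {- unit_vec i | i. i < d}"

text \<open>A walk from the origin is given by its list of steps; its endpoint is their sum.\<close>

definition closed_walks :: "nat \<Rightarrow> nat \<Rightarrow> (nat \<Rightarrow> int) list set" where
  "closed_walks d n = {w. length w = n \<and> set w \<subseteq> steps d \<and> sum_list w = 0}"

definition num_closed_walks :: "nat \<Rightarrow> nat \<Rightarrow> nat" where
  "num_closed_walks d n = card (closed_walks d n)"

lemma finite_steps: "finite (steps d)"
  unfolding steps_def by simp

lemma finite_closed_walks: "finite (closed_walks d n)"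
proof (rule finite_subset)
  show "closed_walks d n \<subseteq> {w. set w \<subseteq> steps d \<and> length w = n}"
    unfolding closed_walks_def by blast
  show "finite {w. set w \<subseteq> steps d \<and> length w = n}"
    using finite_steps by (rule finite_lists_length_eq)
qed

lemma num_closed_walks_0: "num_closed_walks d 0 = 1"
proof -
  have "closed_walks d 0 = {[]}"
    unfolding closed_walks_def by auto
  then show ?thesis
    unfolding num_closed_walks_def by simp
qed

end

theory Submission
  imports Defs
begin

text \<open>
  In a walk in dimension \<open>d + 1\<close>, separate the steps along the last axis from the others. The
  walk closes up iff both subsequences do, and the walk is recovered from the two subsequences
  and the way in which they are interleaved, which is arbitrary (\<open>card_closed_words_Un\<close>). Along a
  single axis, a closed walk of length \<open>2 j\<close> is an arrangement of \<open>j\<close> forward and \<open>j\<close> backward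
  steps, and there is none of odd length. Hence
  \[A_{2m}^{(d+1)} = \sum_{k=0}^m \binom{2m}{2k} A_{2k}^{(d)} \binom{2m-2k}{m-k},\]
  and the product of the two binomial coefficients is rewritten in the required form by
  comparing factorials (\<open>binomial_double_product\<close>).
\<close>

section \<open>Words with sum zero over a union of two alphabets\<close>

definition closed_words :: "'a::comm_monoid_add set \<Rightarrow> nat \<Rightarrow> 'a list set" where
  "closed_words S n = {w. length w = n \<and> set w \<subseteq> S \<and> sum_list w = 0}"

lemma finite_closed_words:
  assumes "finite S"
  shows "finite (closed_words S n)"
  by (rule finite_subset[OF _ finite_lists_length_eq[OF assms, of n]])
    (auto simp: closed_words_def)

lemma sum_list_partition:
  fixes w :: "'a::comm_monoid_add list"
  shows "sum_list w = sum_list (filter P w) + sum_list (filter (\<lambda>x. \<not> P x) w)"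
  by (induction w) (auto simp: ac_simps)

text \<open>
  The second hypothesis says that the sums over \<open>S\<close> and those over \<open>T\<close> cannot cancel each other,
  as for steps in complementary subspaces. The filters onto \<open>S\<close> and \<open>T\<close> then map a closed word to
  a pair of closed words, and the fibre over such a pair is the set of its shuffles, whose
  number depends only on the two lengths.
\<close>

lemma card_closed_words_Un:
  fixes S T :: "'a::comm_monoid_add set"
  assumes fin: "finite S" "finite T" and disj: "S \<inter> T = {}"
    and indep: "\<And>xs ys. set xs \<subseteq> S \<Longrightarrow> set ys \<subseteq> T \<Longrightarrow> sum_list xs + sum_list ys = 0 \<Longrightarrow>
      sum_list xs = 0 \<and> sum_list ys = 0"
  shows "card (closed_words (S \<union> T) n) =
    (\<Sum>j\<le>n. (n choose j) * card (closed_words S j) * card (closed_words T (n - j)))"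
proof -
  define J where
    "J = (SIGMA j:{..n}. closed_words S j \<times> closed_words T (n - j))"
  define F where "F = (\<lambda>p::nat \<times> 'a list \<times> 'a list. shuffles (fst (snd p)) (snd (snd p)))"
  have fibre: "filter (\<lambda>x. x \<in> S) w = xs \<and> filter (\<lambda>x. x \<notin> S) w = ys"
    if "w \<in> shuffles xs ys" "set xs \<subseteq> S" "set ys \<subseteq> T" for w xs ys
  proof -
    have "partition (\<lambda>x. x \<in> S) -` {(xs, ys)} = shuffles xs ys"
      using that disj by (intro inv_image_partition) auto
    then show ?thesis using that(1) by (auto simp: o_def)
  qed
  have "closed_words (S \<union> T) n = (\<Union>p\<in>J. F p)"
  proof (intro equalityI subsetI)
    fix w assume w: "w \<in> closed_words (S \<union> T) n"
    let ?xs = "filter (\<lambda>x. x \<in> S) w" and ?ys = "filter (\<lambda>x. x \<notin> S) w"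
    have len: "length ?xs + length ?ys = n"
      using w sum_length_filter_compl[of "\<lambda>x. x \<in> S" w] by (simp add: closed_words_def)
    have sub: "set ?xs \<subseteq> S" "set ?ys \<subseteq> T"
      using w by (auto simp: closed_words_def)
    have "sum_list ?xs + sum_list ?ys = 0"
      using w sum_list_partition[of w "\<lambda>x. x \<in> S"] by (simp add: closed_words_def)
    with indep[OF sub] sub len have "(length ?xs, ?xs, ?ys) \<in> J"
      by (auto simp: J_def closed_words_def)
    moreover have "w \<in> F (length ?xs, ?xs, ?ys)"
      unfolding F_def by (simp add: partition_in_shuffles)
    ultimately show "w \<in> (\<Union>p\<in>J. F p)" by blast
  next
    fix w assume "w \<in> (\<Union>p\<in>J. F p)"
    then obtain j xs ys where p: "j \<le> n" "xs \<in> closed_words S j" "ys \<in> closed_words T (n - j)"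
      and w: "w \<in> shuffles xs ys" by (auto simp: J_def F_def)
    from p fibre[OF w] have "sum_list w = 0"
      using sum_list_partition[of w "\<lambda>x. x \<in> S"] by (simp add: closed_words_def)
    with p w show "w \<in> closed_words (S \<union> T) n"
      by (auto simp: closed_words_def length_shuffles set_shuffles)
  qed
  moreover have "card (\<Union>p\<in>J. F p) = (\<Sum>p\<in>J. card (F p))"
  proof (rule card_UN_disjoint)
    show "finite J"
      unfolding J_def by (intro finite_SigmaI finite_cartesian_product finite_closed_words fin) simp
    show "\<forall>p\<in>J. finite (F p)" by (simp add: F_def)
    show "\<forall>p\<in>J. \<forall>q\<in>J. p \<noteq> q \<longrightarrow> F p \<inter> F q = {}"
    proof (intro ballI impI equals0I)
      fix p q w assume pq: "p \<in> J" "q \<in> J" "p \<noteq> q" and w: "w \<in> F p \<inter> F q"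
      have "snd r = (filter (\<lambda>x. x \<in> S) w, filter (\<lambda>x. x \<notin> S) w) \<and> fst r = length (fst (snd r))"
        if "r \<in> J" "w \<in> F r" for r
        using that fibre by (auto simp: J_def F_def closed_words_def)
      with pq w show False by (metis IntD1 IntD2 prod_eq_iff)
    qed
  qed
  moreover have "(\<Sum>p\<in>J. card (F p)) = (\<Sum>p\<in>J. n choose fst p)"
  proof (rule sum.cong)
    fix p assume "p \<in> J"
    then obtain j xs ys where p: "p = (j, xs, ys)" "j \<le> n"
      "xs \<in> closed_words S j" "ys \<in> closed_words T (n - j)" by (auto simp: J_def)
    with disj have "set xs \<inter> set ys = {}" by (auto simp: closed_words_def)
    with p show "card (F p) = n choose fst p"
      by (simp add: F_def card_disjoint_shuffles closed_words_def)
  qed simp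
  moreover have "(\<Sum>p\<in>J. n choose fst p) =
    (\<Sum>j\<le>n. \<Sum>p\<in>closed_words S j \<times> closed_words T (n - j). n choose j)"
    unfolding J_def
    by (subst sum.Sigma) (simp_all add: finite_closed_words fin split_beta)
  moreover have "\<dots> =
    (\<Sum>j\<le>n. (n choose j) * card (closed_words S j) * card (closed_words T (n - j)))"
    by (simp add: card_cartesian_product mult.commute mult.left_commute)
  ultimately show ?thesis by metis
qed

section \<open>Closed walks along one axis\<close>

lemma uminus_unit_vec_neq: "- unit_vec i \<noteq> unit_vec i"
proof
  assume "- unit_vec i = unit_vec i"
  from fun_cong[OF this, of i] show False by (simp add: unit_vec_def)
qed

lemma sum_list_axis:
  assumes "set w \<subseteq> {unit_vec i, - unit_vec i}"
  shows "sum_list w i = int (length (filter (\<lambda>v. v = unit_vec i) w))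
    - int (length (filter (\<lambda>v. v \<noteq> unit_vec i) w))"
  using assms by (induction w) (auto simp: unit_vec_def uminus_unit_vec_neq)

lemma sum_list_eq_0_outside:
  fixes w :: "('b \<Rightarrow> 'a::comm_monoid_add) list"
  assumes "\<And>v. v \<in> set w \<Longrightarrow> v j = 0"
  shows "sum_list w j = 0"
  using assms by (induction w) auto

text \<open>
  The \<open>i\<close>-th coordinate of the endpoint is the number of forward steps minus the number of
  backward steps, so a closed word has equally many of both, and it is a shuffle of its two
  constant subwords.
\<close>

lemma closed_words_axis:
  assumes "w \<in> closed_words {unit_vec i, - unit_vec i} n"
  shows "\<exists>j. n = 2 * j \<and> w \<in> shuffles (replicate j (unit_vec i)) (replicate j (- unit_vec i))"
proof -
  let ?xs = "filter (\<lambda>v. v = unit_vec i) w" and ?ys = "filter (\<lambda>v. v \<noteq> unit_vec i) w"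
  from assms have w: "length w = n" "set w \<subseteq> {unit_vec i, - unit_vec i}" "sum_list w = 0"
    by (auto simp: closed_words_def)
  with sum_list_axis[OF w(2)] have eq: "length ?ys = length ?xs" by simp
  have xs: "?xs = replicate (length ?xs) (unit_vec i)"
    by (rule replicate_eqI) auto
  have ys: "?ys = replicate (length ?xs) (- unit_vec i)"
    using w(2) by (intro replicate_eqI eq) auto
  have "n = 2 * length ?xs"
    using eq w(1) sum_length_filter_compl[of "\<lambda>v. v = unit_vec i" w] by simp
  moreover have "w \<in> shuffles ?xs ?ys" by (rule partition_in_shuffles)
  ultimately show ?thesis using xs ys by metis
qed

lemma card_closed_words_axis_odd:
  assumes "odd n"
  shows "card (closed_words {unit_vec i, - unit_vec i} n) = 0"
proof -
  have "closed_words {unit_vec i, - unit_vec i} n = {}"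
    using closed_words_axis assms by (metis dvd_triv_left equals0I)
  then show ?thesis by simp
qed

lemma card_closed_words_axis_even:
  "card (closed_words {unit_vec i, - unit_vec i} (2 * j)) = (2 * j) choose j"
proof -
  let ?xs = "replicate j (unit_vec i)" and ?ys = "replicate j (- unit_vec i)"
  have "closed_words {unit_vec i, - unit_vec i} (2 * j) = shuffles ?xs ?ys"
  proof (intro equalityI subsetI)
    fix w assume "w \<in> closed_words {unit_vec i, - unit_vec i} (2 * j)"
    then show "w \<in> shuffles ?xs ?ys" using closed_words_axis by fastforce
  next
    fix w assume w: "w \<in> shuffles ?xs ?ys"
    have sub: "set w \<subseteq> {unit_vec i, - unit_vec i}" using set_shuffles[OF w] by auto
    have "partition (\<lambda>v. v = unit_vec i) -` {(?xs, ?ys)} = shuffles ?xs ?ys"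
      by (rule inv_image_partition) (auto simp: uminus_unit_vec_neq)
    with w have f: "filter (\<lambda>v. v = unit_vec i) w = ?xs" "filter (\<lambda>v. v \<noteq> unit_vec i) w = ?ys"
      by (auto simp: o_def)
    have "sum_list w k = 0" for k
    proof (cases "k = i")
      case True
      with sum_list_axis[OF sub] f show ?thesis by simp
    next
      case False
      with sub show ?thesis by (intro sum_list_eq_0_outside) (auto simp: unit_vec_def)
    qed
    then show "w \<in> closed_words {unit_vec i, - unit_vec i} (2 * j)"
      using sub length_shuffles[OF w] by (auto simp: closed_words_def)
  qed
  moreover have "set ?xs \<inter> set ?ys = {}"
    using uminus_unit_vec_neq[of i] by (cases j) auto
  ultimately show ?thesis by (simp only: card_disjoint_shuffles length_replicate mult_2)
qed

section \<open>Splitting off the last coordinate\<close>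

lemma num_closed_walks_eq: "num_closed_walks d n = card (closed_words (steps d) n)"
  by (simp add: num_closed_walks_def closed_walks_def closed_words_def)

lemma steps_Suc: "steps (Suc d) = steps d \<union> {unit_vec d, - unit_vec d}"
  by (auto simp: steps_def less_Suc_eq)

lemma steps_apply_outside: "v \<in> steps d \<Longrightarrow> d \<le> j \<Longrightarrow> v j = 0"
  by (auto simp: steps_def unit_vec_def)

text \<open>
  Words over \<open>steps d\<close> have sums with vanishing coordinate \<open>d\<close>, whereas sums along axis \<open>d\<close> vanish
  at all other coordinates; this is why the two cannot cancel.
\<close>

lemma num_closed_walks_Suc:
  "num_closed_walks (Suc d) n =
    (\<Sum>j\<le>n. (n choose j) * num_closed_walks d j *
      card (closed_words {unit_vec d, - unit_vec d} (n - j)))"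
  unfolding num_closed_walks_eq steps_Suc
proof (rule card_closed_words_Un)
  have "unit_vec d \<notin> steps d" "- unit_vec d \<notin> steps d"
    using steps_apply_outside[of _ d d] by (force simp: unit_vec_def)+
  then show "steps d \<inter> {unit_vec d, - unit_vec d} = {}" by blast
next
  fix xs ys :: "(nat \<Rightarrow> int) list"
  assume xs: "set xs \<subseteq> steps d" and ys: "set ys \<subseteq> {unit_vec d, - unit_vec d}"
    and sum: "sum_list xs + sum_list ys = 0"
  have X: "sum_list xs d = 0"
    using xs by (intro sum_list_eq_0_outside) (auto dest: steps_apply_outside)
  have Y: "sum_list ys k = 0" if "k \<noteq> d" for k
    using ys that by (intro sum_list_eq_0_outside) (auto simp: unit_vec_def)
  have S: "sum_list xs k + sum_list ys k = 0" for k
    using fun_cong[OF sum, of k] by simp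
  have "sum_list xs k = 0 \<and> sum_list ys k = 0" for k
    using X Y[of k] S[of k] by (cases "k = d") auto
  then show "sum_list xs = 0 \<and> sum_list ys = 0" by (auto simp: fun_eq_iff)
qed (simp_all add: finite_steps)

lemma num_closed_walks_Suc_even:
  "num_closed_walks (Suc d) (2 * m) =
    (\<Sum>k\<le>m. ((2 * m) choose (2 * k)) * num_closed_walks d (2 * k) * ((2 * (m - k)) choose (m - k)))"
proof -
  let ?f = "\<lambda>j. ((2 * m) choose j) * num_closed_walks d j *
      card (closed_words {unit_vec d, - unit_vec d} (2 * m - j))"
  \<comment> \<open>For odd \<open>j\<close> the remaining \<open>2 * m - j\<close> steps along the axis cannot close up.\<close>
  have "(\<Sum>j\<le>2 * m. ?f j) = (\<Sum>j\<in>(\<lambda>k. 2 * k) ` {..m}. ?f j)"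
  proof (rule sum.mono_neutral_right)
    show "\<forall>j\<in>{..2 * m} - (\<lambda>k. 2 * k) ` {..m}. ?f j = 0"
    proof
      fix j assume j: "j \<in> {..2 * m} - (\<lambda>k. 2 * k) ` {..m}"
      have "odd j"
      proof
        assume "even j"
        then obtain k where "j = 2 * k" by (rule evenE)
        with j show False by auto
      qed
      with j have "odd (2 * m - j)" by simp
      then show "?f j = 0" by (simp add: card_closed_words_axis_odd)
    qed
  qed auto
  also have "\<dots> = (\<Sum>k\<le>m. ?f (2 * k))"
    by (subst sum.reindex) (auto simp: inj_on_def)
  also have "\<dots> = (\<Sum>k\<le>m. ((2 * m) choose (2 * k)) * num_closed_walks d (2 * k) *
      ((2 * (m - k)) choose (m - k)))"
    by (simp add: card_closed_words_axis_even flip: diff_mult_distrib2)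
  finally show ?thesis by (simp add: num_closed_walks_Suc)
qed

text \<open>Both sides equal \<open>(2m)! / ((2k)! (m-k)!\<^sup>2)\<close>.\<close>

lemma binomial_double_product:
  assumes "k \<le> m"
  shows "real ((2 * m) choose (2 * k)) * real ((2 * (m - k)) choose (m - k)) =
    real ((2 * m) choose m) * (real (m choose k))\<^sup>2 / real ((2 * k) choose k)"
proof -
  from assms obtain n where m: "m = k + n" by (auto simp: le_iff_add)
  have minus: "2 * (k + n) - 2 * k = 2 * n" "2 * i - i = i" for i :: nat by auto
  have "real ((2 * (k + n)) choose (2 * k)) = fact (2 * (k + n)) / (fact (2 * k) * fact (2 * n))"
    "real ((2 * i) choose i) = fact (2 * i) / (fact i * fact i)"
    "real ((k + n) choose k) = fact (k + n) / (fact k * fact n)" for i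
    by (simp_all add: binomial_fact minus del: distrib_left_numeral)
  then show ?thesis
    by (simp add: m power2_eq_square del: distrib_left_numeral)
qed

theorem corollary1:
  fixes d m :: nat
  assumes "d \<ge> 1"
  shows "real (num_closed_walks (d + 1) (2 * m)) =
    real ((2 * m) choose m) *
      (\<Sum>k=0..m. (real (m choose k))\<^sup>2 *
        (real (num_closed_walks d (2 * k)) / real ((2 * k) choose k)))"
proof -
  have "real (num_closed_walks (d + 1) (2 * m)) =
    (\<Sum>k\<le>m. real ((2 * m) choose (2 * k)) * real ((2 * (m - k)) choose (m - k)) *
      real (num_closed_walks d (2 * k)))"
    unfolding Suc_eq_plus1[symmetric] num_closed_walks_Suc_even of_nat_sum of_nat_mult
    by (simp only: mult_ac)
  also have "\<dots> = (\<Sum>k\<le>m. real ((2 * m) choose m) * ((real (m choose k))\<^sup>2 *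
        (real (num_closed_walks d (2 * k)) / real ((2 * k) choose k))))"
    by (intro sum.cong refl) (simp only: atMost_iff binomial_double_product times_divide_eq_right
      times_divide_eq_left mult.assoc)
  finally show ?thesis by (simp only: sum_distrib_left atMost_atLeast0)
qed

end
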